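(* Let $G$ be a $\overline{C}$-group with a fixed $\overline{C}$-type presentation $\Pi$. Then there is a group isomorphism $$A(G)\ \cong\ G^{\mathcal{D}}\times\mathbb{Z}^{\mathfrak{C}_{\mathrm{ng}}(G)},$$ where $\mathfrak{C}_{\mathrm{ng}}(G)$ is the set of conjugacy classes of $G$ containing no generators from $\Pi$.
   Context: For a quandle $(Q,\triangleleft)$, its structure group is $\mathrm{As}(Q)=\langle e_a,\ a\in Q\mid e_ae_b=e_be_{a\triangleleft b},\ a,b\in Q\rangle$. A group $G$ is a quandle $\mathrm{Conj}(G)$ with $a\triangleleft b=b^{-1}ab$; put $A(G)=\mathrm{As}(\mathrm{Conj}(G))$. For a set $X$, $\mathbb{Z}^{X}$ denotes the free abelian group with basis $X$ (direct sum). A $\overline{C}$-group is a group $G$ admitting a presentation $\Pi$ (a $\overline{C}$-type presentation), with some generator set $\Gamma$, in which every relation is either a conjugation relation $b^{-1}ab=c$ with $a,b,c\in\Gamma$, or a power relation $a^k=1$ with $a\in\Gamma$, $k\ge 2$; there is at most one power relation per conjugacy class of $G$ (i.e., for each conjugacy class $\mathcal{O}$ of $G$, at most one power relation $a^k=1$ has $a\in\mathcal{O}$). The Dehn quandle $\Gamma^G$ is the union of the $G$-conjugacy classes of the elements of $\Gamma$ in $G$, a subquandle of $\mathrm{Conj}(G)$, and $G^{\mathcal{D}}:=\mathrm{As}(\Gamma^G)$. *)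

theory Defs
  imports "HOL-Algebra.Group" "HOL-Algebra.Free_Abelian_Groups"
begin

section \<open>Groups given by generators and relations\<close>

text \<open>A letter \<open>(x, True)\<close> stands for the generator \<open>x\<close>, and \<open>(x, False)\<close> for its formal inverse.
  A pair of words \<open>(l, r)\<close> stands for the relation \<open>l = r\<close>.\<close>

type_synonym 'x word = "('x \<times> bool) list"

definition words :: "'x set \<Rightarrow> 'x word set" where
  "words X = lists (X \<times> UNIV)"

inductive word_eq :: "'x set \<Rightarrow> ('x word \<times> 'x word) set \<Rightarrow> 'x word \<Rightarrow> 'x word \<Rightarrow> bool"
  for X R where
  refl: "u \<in> words X \<Longrightarrow> word_eq X R u u"
| sym: "word_eq X R u v \<Longrightarrow> word_eq X R v u"
| trans: "word_eq X R u v \<Longrightarrow> word_eq X R v w \<Longrightarrow> word_eq X R u w"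
| append: "word_eq X R u u' \<Longrightarrow> word_eq X R v v' \<Longrightarrow> word_eq X R (u @ v) (u' @ v')"
| cancel: "x \<in> X \<Longrightarrow> word_eq X R [(x, b), (x, \<not> b)] []"
| rel: "(l, r) \<in> R \<Longrightarrow> l \<in> words X \<Longrightarrow> r \<in> words X \<Longrightarrow> word_eq X R l r"

definition word_class :: "'x set \<Rightarrow> ('x word \<times> 'x word) set \<Rightarrow> 'x word \<Rightarrow> 'x word set" where
  "word_class X R u = {v. word_eq X R u v}"

definition presented_group :: "'x set \<Rightarrow> ('x word \<times> 'x word) set \<Rightarrow> 'x word set monoid" where
  "presented_group X R =
    \<lparr>carrier = word_class X R ` words X,
     monoid.mult = (\<lambda>A B. {w. \<exists>u\<in>A. \<exists>v\<in>B. word_eq X R (u @ v) w}),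
     one = word_class X R []\<rparr>"

text \<open>\<open>\<langle>X | R\<rangle>\<close> is a presentation of \<open>G\<close>, the generator \<open>x\<close> naming the element \<open>\<iota> x\<close> of \<open>G\<close>.
  The map \<open>\<iota>\<close> is not required to be injective: distinct generators may name the same element.\<close>

definition is_presentation ::
  "('a, 'm) monoid_scheme \<Rightarrow> 'x set \<Rightarrow> ('x word \<times> 'x word) set \<Rightarrow> ('x \<Rightarrow> 'a) \<Rightarrow> bool" where
  "is_presentation G X R \<iota> \<longleftrightarrow>
     R \<subseteq> words X \<times> words X \<and>
     (\<exists>\<phi> \<in> iso (presented_group X R) G. \<forall>x\<in>X. \<phi> (word_class X R [(x, True)]) = \<iota> x)"

lemma words_simps [simp]:
  "[] \<in> words X"
  "p # u \<in> words X \<longleftrightarrow> fst p \<in> X \<and> u \<in> words X"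
  "u @ v \<in> words X \<longleftrightarrow> u \<in> words X \<and> v \<in> words X"
  by (auto simp: words_def mem_Times_iff)

lemma word_eq_words: "word_eq X R u v \<Longrightarrow> u \<in> words X \<and> v \<in> words X"
  by (induction rule: word_eq.induct) auto

lemma word_class_eq_iff:
  assumes "v \<in> words X"
  shows "word_class X R u = word_class X R v \<longleftrightarrow> word_eq X R u v"
  using assms unfolding word_class_def
  by (blast intro: word_eq.refl word_eq.sym word_eq.trans)

lemma presented_group_mult:
  assumes "u \<in> words X" "v \<in> words X"
  shows "word_class X R u \<otimes>\<^bsub>presented_group X R\<^esub> word_class X R v = word_class X R (u @ v)"
  using assms unfolding word_class_def presented_group_def
  by (auto intro: word_eq.refl word_eq.trans word_eq.append)

lemma word_eq_inverse:
  "u \<in> words X \<Longrightarrow>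
    word_eq X R (map (\<lambda>(x, b). (x, \<not> b)) (rev u) @ u) []"
proof (induction u)
  case Nil
  then show ?case by (auto intro: word_eq.refl)
next
  case (Cons p u)
  obtain x b where p: "p = (x, b)" by (cases p)
  let ?i = "map (\<lambda>(x, b). (x, \<not> b)) (rev u)"
  from Cons have u: "u \<in> words X" and x: "x \<in> X"
    and IH: "word_eq X R (?i @ u) []" by (auto simp: p)
  have i: "?i \<in> words X" using word_eq_words[OF IH] by simp
  have "word_eq X R [(x, \<not> b), (x, b)] []"
    using word_eq.cancel[OF x, of R "\<not> b"] by simp
  from word_eq.append[OF word_eq.append[OF word_eq.refl[OF i] this] word_eq.refl[OF u]]
  have "word_eq X R (?i @ [(x, \<not> b), (x, b)] @ u) (?i @ u)" by simp
  from word_eq.trans[OF this IH] show ?case by (simp add: p)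
qed

lemma group_presented_group: "group (presented_group X R)"
proof (rule groupI)
  let ?P = "presented_group X R"
  have car: "carrier ?P = word_class X R ` words X"
    and one: "\<one>\<^bsub>?P\<^esub> = word_class X R []" by (simp_all add: presented_group_def)
  show "a \<otimes>\<^bsub>?P\<^esub> b \<in> carrier ?P" if "a \<in> carrier ?P" "b \<in> carrier ?P" for a b
    using that by (auto simp: car presented_group_mult)
  show "\<one>\<^bsub>?P\<^esub> \<in> carrier ?P" by (simp add: car one)
  show "a \<otimes>\<^bsub>?P\<^esub> b \<otimes>\<^bsub>?P\<^esub> c = a \<otimes>\<^bsub>?P\<^esub> (b \<otimes>\<^bsub>?P\<^esub> c)"
    if "a \<in> carrier ?P" "b \<in> carrier ?P" "c \<in> carrier ?P" for a b c
    using that by (auto simp: car presented_group_mult)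
  show "\<one>\<^bsub>?P\<^esub> \<otimes>\<^bsub>?P\<^esub> a = a" if "a \<in> carrier ?P" for a
    using that by (auto simp: car one presented_group_mult)
  show "\<exists>b\<in>carrier ?P. b \<otimes>\<^bsub>?P\<^esub> a = \<one>\<^bsub>?P\<^esub>" if "a \<in> carrier ?P" for a
  proof -
    from that obtain u where u: "u \<in> words X" "a = word_class X R u" by (auto simp: car)
    have e: "word_eq X R (map (\<lambda>(x, b). (x, \<not> b)) (rev u) @ u) []"
      by (rule word_eq_inverse[OF u(1)])
    then have "map (\<lambda>(x, b). (x, \<not> b)) (rev u) \<in> words X"
      by (auto dest: word_eq_words)
    with e u show ?thesis
      by (auto simp: car one presented_group_mult word_class_eq_iff)
  qed
qed

primrec eval_word :: "('a, 'm) monoid_scheme \<Rightarrow> ('x \<Rightarrow> 'a) \<Rightarrow> 'x word \<Rightarrow> 'a" where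
  "eval_word G f [] = \<one>\<^bsub>G\<^esub>"
| "eval_word G f (p # u) =
    (if snd p then f (fst p) else inv\<^bsub>G\<^esub> f (fst p)) \<otimes>\<^bsub>G\<^esub> eval_word G f u"

lemma presented_group_universal:
  assumes G: "group G" and f: "f \<in> X \<rightarrow> carrier G"
    and R: "\<And>l r. (l, r) \<in> R \<Longrightarrow> l \<in> words X \<Longrightarrow> r \<in> words X
                \<Longrightarrow> eval_word G f l = eval_word G f r"
  shows "\<exists>h \<in> hom (presented_group X R) G.
           \<forall>u \<in> words X. h (word_class X R u) = eval_word G f u"
proof -
  interpret G: group G by (rule G)
  have cl: "eval_word G f u \<in> carrier G" if "u \<in> words X" for u
    using that f by (induction u) (auto simp: Pi_iff)
  have app: "eval_word G f (u @ v) = eval_word G f u \<otimes>\<^bsub>G\<^esub> eval_word G f v"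
    if "u \<in> words X" "v \<in> words X" for u v
    using that f by (induction u) (auto simp: Pi_iff cl G.m_assoc)
  have eq: "eval_word G f u = eval_word G f v" if "word_eq X R u v" for u v
    using that
  proof (induction rule: word_eq.induct)
    case (append u u' v v')
    then show ?case by (auto simp: app dest!: word_eq_words)
  next
    case (cancel x b)
    then show ?case using f by (cases b) (auto simp: Pi_iff)
  qed (auto intro: R)
  define h where "h A = eval_word G f (SOME u. u \<in> A)" for A
  have h: "h (word_class X R u) = eval_word G f u" if "u \<in> words X" for u
  proof -
    have "u \<in> word_class X R u" using that by (auto simp: word_class_def intro: word_eq.refl)
    then have "(SOME v. v \<in> word_class X R u) \<in> word_class X R u" by (rule someI)
    then show ?thesis by (simp add: h_def word_class_def eq)
  qed
  have "h \<in> hom (presented_group X R) G"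
  proof (rule homI)
    fix A B assume "A \<in> carrier (presented_group X R)" "B \<in> carrier (presented_group X R)"
    then obtain u v where uv: "u \<in> words X" "v \<in> words X"
      "A = word_class X R u" "B = word_class X R v"
      by (auto simp: presented_group_def)
    then show "h (A \<otimes>\<^bsub>presented_group X R\<^esub> B) = h A \<otimes>\<^bsub>G\<^esub> h B"
      by (simp add: presented_group_mult h app)
  qed (auto simp: presented_group_def h cl)
  with h show ?thesis by blast
qed


section \<open>Quandles and their structure groups\<close>

record 'a qdl = "'a partial_object" +
  qop :: "'a \<Rightarrow> 'a \<Rightarrow> 'a" (infixl \<open>\<lhd>\<^sub>q\<index>\<close> 70)

locale quandle =
  fixes Q (structure)
  assumes closed: "a \<in> carrier Q \<Longrightarrow> b \<in> carrier Q \<Longrightarrow> a \<lhd>\<^sub>q b \<in> carrier Q"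
    and idem: "a \<in> carrier Q \<Longrightarrow> a \<lhd>\<^sub>q a = a"
    and bij: "b \<in> carrier Q \<Longrightarrow> bij_betw (\<lambda>a. a \<lhd>\<^sub>q b) (carrier Q) (carrier Q)"
    and self_distrib: "a \<in> carrier Q \<Longrightarrow> b \<in> carrier Q \<Longrightarrow> c \<in> carrier Q
          \<Longrightarrow> (a \<lhd>\<^sub>q b) \<lhd>\<^sub>q c = (a \<lhd>\<^sub>q c) \<lhd>\<^sub>q (b \<lhd>\<^sub>q c)"

definition As :: "('a, 'm) qdl_scheme \<Rightarrow> 'a word set monoid" where
  "As Q = presented_group (carrier Q)
     {([(a, True), (b, True)], [(b, True), (a \<lhd>\<^sub>q\<^bsub>Q\<^esub> b, True)]) | a b.
        a \<in> carrier Q \<and> b \<in> carrier Q}"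

definition Conj :: "('a, 'm) monoid_scheme \<Rightarrow> 'a qdl" where
  "Conj G = \<lparr>carrier = carrier G, qop = (\<lambda>a b. inv\<^bsub>G\<^esub> b \<otimes>\<^bsub>G\<^esub> a \<otimes>\<^bsub>G\<^esub> b)\<rparr>"

definition A_group :: "('a, 'm) monoid_scheme \<Rightarrow> 'a word set monoid" where
  "A_group G = As (Conj G)"


section \<open>Conjugacy classes and Dehn quandles\<close>

definition conj_class :: "('a, 'm) monoid_scheme \<Rightarrow> 'a \<Rightarrow> 'a set" where
  "conj_class G a = {inv\<^bsub>G\<^esub> g \<otimes>\<^bsub>G\<^esub> a \<otimes>\<^bsub>G\<^esub> g | g. g \<in> carrier G}"

definition conj_classes :: "('a, 'm) monoid_scheme \<Rightarrow> 'a set set" where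
  "conj_classes G = conj_class G ` carrier G"

definition Dehn_quandle :: "('a, 'm) monoid_scheme \<Rightarrow> 'a set \<Rightarrow> 'a qdl" where
  "Dehn_quandle G \<Gamma> = (Conj G)\<lparr>carrier := (\<Union>a\<in>\<Gamma>. conj_class G a)\<rparr>"

definition Dehn_group :: "('a, 'm) monoid_scheme \<Rightarrow> 'a set \<Rightarrow> 'a word set monoid" where
  "Dehn_group G \<Gamma> = As (Dehn_quandle G \<Gamma>)"

definition nongen_classes :: "('a, 'm) monoid_scheme \<Rightarrow> 'a set \<Rightarrow> 'a set set" where
  "nongen_classes G \<Gamma> = {C \<in> conj_classes G. C \<inter> \<Gamma> = {}}"

lemma (in group) conj_class_closed: "a \<in> carrier G \<Longrightarrow> conj_class G a \<subseteq> carrier G"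
  by (auto simp: conj_class_def)

lemma (in group) conj_class_conj:
  assumes "a \<in> carrier G" "x \<in> conj_class G a" "b \<in> carrier G"
  shows "inv b \<otimes> x \<otimes> b \<in> conj_class G a"
proof -
  from assms obtain g where g: "g \<in> carrier G" "x = inv g \<otimes> a \<otimes> g"
    by (auto simp: conj_class_def)
  with assms have "inv b \<otimes> x \<otimes> b = inv (g \<otimes> b) \<otimes> a \<otimes> (g \<otimes> b)"
    by (simp add: inv_mult_group m_assoc)
  with assms g show ?thesis unfolding conj_class_def by blast
qed

lemma (in group) quandle_Dehn_quandle:
  assumes \<Gamma>: "\<Gamma> \<subseteq> carrier G"
  shows "quandle (Dehn_quandle G \<Gamma>)"
proof -
  define D where "D = (\<Union>a\<in>\<Gamma>. conj_class G a)"
  have D: "x \<in> carrier G" if "x \<in> D" for x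
    using that \<Gamma> conj_class_closed by (auto simp: D_def)
  have cl: "inv b \<otimes> x \<otimes> b \<in> D" if "x \<in> D" "b \<in> carrier G" for x b
    using that \<Gamma> conj_class_conj unfolding D_def by blast
  have c1: "inv b \<otimes> (b \<otimes> x \<otimes> inv b) \<otimes> b = x" "b \<otimes> (inv b \<otimes> x \<otimes> b) \<otimes> inv b = x"
    if "b \<in> carrier G" "x \<in> carrier G" for b x
  proof -
    have k: "b \<otimes> (inv b \<otimes> z) = z" "inv b \<otimes> (b \<otimes> z) = z" if "z \<in> carrier G" for z
      using that \<open>b \<in> carrier G\<close> by (simp_all flip: m_assoc)
    show "inv b \<otimes> (b \<otimes> x \<otimes> inv b) \<otimes> b = x" "b \<otimes> (inv b \<otimes> x \<otimes> b) \<otimes> inv b = x"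
      using that by (simp_all add: m_assoc k)
  qed
  have sd: "inv c \<otimes> (inv b \<otimes> a \<otimes> b) \<otimes> c
      = inv (inv c \<otimes> b \<otimes> c) \<otimes> (inv c \<otimes> a \<otimes> c) \<otimes> (inv c \<otimes> b \<otimes> c)"
    if "a \<in> carrier G" "b \<in> carrier G" "c \<in> carrier G" for a b c
  proof -
    have k: "c \<otimes> (inv c \<otimes> z) = z" if "z \<in> carrier G" for z
      using that \<open>c \<in> carrier G\<close> by (simp flip: m_assoc)
    show ?thesis using that by (simp add: inv_mult_group m_assoc k)
  qed
  show ?thesis
    unfolding quandle_def Dehn_quandle_def Conj_def
    apply (simp flip: D_def)
    apply (intro conjI allI impI)
    subgoal by (simp add: cl D)
    subgoal by (simp add: D)
    subgoal for b
    proof (rule bij_betw_byWitness[where f' = "\<lambda>a. b \<otimes> a \<otimes> inv b"])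
      assume "b \<in> D"
      then have b: "b \<in> carrier G" by (rule D)
      show "(\<lambda>a. b \<otimes> a \<otimes> inv b) ` D \<subseteq> D"
        using cl[of _ "inv b"] b by auto
    qed (use c1 cl D in auto)
    subgoal by (rule sd; rule D)
    done
qed

lemma (in group) Dehn_quandle_carrier: "Dehn_quandle G (carrier G) = Conj G"
proof -
  have "x \<in> conj_class G x" if "x \<in> carrier G" for x
    using that unfolding conj_class_def by (auto intro!: exI[of _ "\<one>"])
  then have "(\<Union>a\<in>carrier G. conj_class G a) = carrier G"
    using conj_class_closed by blast
  then show ?thesis by (simp add: Dehn_quandle_def Conj_def)
qed

lemma (in group) quandle_Conj: "quandle (Conj G)"
  using quandle_Dehn_quandle[of "carrier G"] by (simp add: Dehn_quandle_carrier)


section \<open>\<open>C\<close>-bar-type presentations\<close>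

definition conj_relation :: "'x \<Rightarrow> 'x \<Rightarrow> 'x \<Rightarrow> 'x word \<times> 'x word" where
  "conj_relation a b c = ([(b, False), (a, True), (b, True)], [(c, True)])"

definition power_relation :: "'x \<Rightarrow> nat \<Rightarrow> 'x word \<times> 'x word" where
  "power_relation a k = (replicate k (a, True), [])"

definition Cbar_presentation ::
  "('a, 'm) monoid_scheme \<Rightarrow> 'x set \<Rightarrow> ('x word \<times> 'x word) set \<Rightarrow> ('x \<Rightarrow> 'a) \<Rightarrow> bool" where
  "Cbar_presentation G X R \<iota> \<longleftrightarrow>
     is_presentation G X R \<iota> \<and>
     (\<forall>r\<in>R. (\<exists>a\<in>X. \<exists>b\<in>X. \<exists>c\<in>X. r = conj_relation a b c) \<or>
            (\<exists>a\<in>X. \<exists>k\<ge>2. r = power_relation a k)) \<and>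
     (\<forall>C\<in>conj_classes G. \<forall>a a' k k'.
        power_relation a k \<in> R \<and> \<iota> a \<in> C \<and> power_relation a' k' \<in> R \<and> \<iota> a' \<in> C
        \<longrightarrow> a = a' \<and> k = k')"

end

theory Submission
  imports Defs
begin

text \<open>
  Let \<open>D = As(\<Gamma>\<^sup>G)\<close> with generators \<open>d\<^sub>a\<close>. The kernel of \<open>proj: D \<rightarrow> G\<close>, \<open>d\<^sub>a \<mapsto> a\<close>, is central because
  \<open>w\<^sup>-\<^sup>1 d\<^sub>a w = d\<^sub>b\<close> for \<open>b = proj(w)\<^sup>-\<^sup>1 a proj(w)\<close>. The conjugation relations already hold in \<open>D\<close>, so the
  kernel is generated by the powers \<open>d\<^sub>a\<^sup>k\<close> coming from the power relations. As there is at most one of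
  these per conjugacy class, the kernel meets the commutator subgroup of \<open>D\<close> trivially: it is
  detected by the homomorphisms \<open>D \<rightarrow> \<int>\<close> counting the generators in a given class. Hence lifts to \<open>D\<close>
  of commuting elements commute, and \<open>proj\<close> has a conjugation-equivariant section \<open>\<sigma>\<close> with
  \<open>\<sigma> a = d\<^sub>a\<close> on \<open>\<Gamma>\<^sup>G\<close>. In \<open>A(G)\<close>, where \<open>D\<close> maps by \<open>d\<^sub>a \<mapsto> e\<^sub>a\<close>, the element \<open>e\<^sub>a \<sigma>(a)\<^sup>-\<^sup>1\<close> is central and
  depends only on the class of \<open>a\<close>; the classes without generators contribute the free abelian
  factor in this way.
\<close>

section \<open>Central elements\<close>

definition center :: "('a, 'm) monoid_scheme \<Rightarrow> 'a set" where
  "center G = {z \<in> carrier G. \<forall>x\<in>carrier G. z \<otimes>\<^bsub>G\<^esub> x = x \<otimes>\<^bsub>G\<^esub> z}"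

lemma center_carrier: "z \<in> center G \<Longrightarrow> z \<in> carrier G"
  by (simp add: center_def)

lemma center_commute: "z \<in> center G \<Longrightarrow> x \<in> carrier G \<Longrightarrow> z \<otimes>\<^bsub>G\<^esub> x = x \<otimes>\<^bsub>G\<^esub> z"
  by (simp add: center_def)

lemma centerI: "z \<in> carrier G \<Longrightarrow> (\<And>x. x \<in> carrier G \<Longrightarrow> z \<otimes>\<^bsub>G\<^esub> x = x \<otimes>\<^bsub>G\<^esub> z) \<Longrightarrow> z \<in> center G"
  by (simp add: center_def)

lemma (in group) inv_commute:
  assumes "a \<in> carrier G" "x \<in> carrier G" "a \<otimes> x = x \<otimes> a"
  shows "inv a \<otimes> x = x \<otimes> inv a"
proof -
  have "inv a \<otimes> x = inv a \<otimes> (x \<otimes> a) \<otimes> inv a"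
    using assms(1,2) by (simp add: m_assoc)
  also have "\<dots> = inv a \<otimes> (a \<otimes> x) \<otimes> inv a" by (simp only: assms(3))
  also have "\<dots> = x \<otimes> inv a" using assms(1,2) by (simp flip: m_assoc)
  finally show ?thesis .
qed

lemma (in group) subgroup_center: "subgroup (center G) G"
proof (rule subgroupI)
  show "inv a \<in> center G" if "a \<in> center G" for a
    using that by (simp add: centerI center_carrier inv_commute[OF _ _ center_commute])
  show "a \<otimes> b \<in> center G" if "a \<in> center G" "b \<in> center G" for a b
  proof -
    have "a \<otimes> b \<otimes> x = x \<otimes> (a \<otimes> b)" if "x \<in> carrier G" for x
    proof -
      have ab: "a \<in> carrier G" "b \<in> carrier G" 
        using \<open>a \<in> center G\<close> \<open>b \<in> center G\<close> by (simp_all add: center_carrier)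
      then have "a \<otimes> b \<otimes> x = a \<otimes> (b \<otimes> x)" using that by (simp add: m_assoc)
      also have "\<dots> = a \<otimes> (x \<otimes> b)" by (simp only: center_commute[OF \<open>b \<in> center G\<close> that])
      also have "\<dots> = a \<otimes> x \<otimes> b" using ab that by (simp add: m_assoc)
      also have "\<dots> = x \<otimes> a \<otimes> b" by (simp only: center_commute[OF \<open>a \<in> center G\<close> that])
      also have "\<dots> = x \<otimes> (a \<otimes> b)" using ab that by (simp add: m_assoc)
      finally show ?thesis .
    qed
    with that show ?thesis by (simp add: centerI center_carrier)
  qed
qed (use centerI[OF one_closed] in \<open>auto intro: center_carrier\<close>)

text \<open>The universal property needs a commutative target, so it is applied to the center,
  regarded as a group. This turns a family of central elements of a noncommutative group into a
  homomorphism whose values stay central.\<close>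

lemma (in group) free_Abelian_group_hom_center:
  assumes "f ` I \<subseteq> center G"
  obtains h where "h \<in> hom (free_Abelian_group I) G" "\<And>i. i \<in> I \<Longrightarrow> h (frag_of i) = f i"
    "\<And>c. c \<in> carrier (free_Abelian_group I) \<Longrightarrow> h c \<in> center G"
proof -
  let ?Z = "G\<lparr>carrier := center G\<rparr>"
  have "group ?Z" by (rule subgroup.subgroup_is_group[OF subgroup_center is_group])
  then interpret Z: comm_group ?Z
    by (rule group.group_comm_groupI) (simp, rule center_commute, auto intro: center_carrier)
  obtain h where h: "h \<in> hom (free_Abelian_group I) ?Z" "\<And>i. i \<in> I \<Longrightarrow> h (frag_of i) = f i"
    using Z.free_Abelian_group_universal[of f I] assms by auto
  show thesis
  proof (rule that[OF _ h(2)])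
    show "h \<in> hom (free_Abelian_group I) G"
      using h(1) by (auto simp: hom_def dest: center_carrier)
    show "h c \<in> center G" if "c \<in> carrier (free_Abelian_group I)" for c
      using hom_in_carrier[OF h(1) that] by simp
  qed
qed

text \<open>Every element arises from 0 and basis elements by differences, and homomorphisms respect
  these. \<open>H\<close> need not be commutative, which matters for targets involving a structure
  group.\<close>

lemma hom_free_Abelian_group_eqI:
  assumes "group H" "g \<in> hom (free_Abelian_group I) H" "h \<in> hom (free_Abelian_group I) H"
    and "\<And>i. i \<in> I \<Longrightarrow> g (frag_of i) = h (frag_of i)"
    and "c \<in> carrier (free_Abelian_group I)"
  shows "g c = h c"
proof -
  interpret H: group H by (rule assms)
  interpret g: group_hom "free_Abelian_group I" H g
    by (intro group_hom.intro group_hom_axioms.intro) (simp_all add: assms)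
  interpret h: group_hom "free_Abelian_group I" H h
    by (intro group_hom.intro group_hom_axioms.intro) (simp_all add: assms)
  have "Poly_Mapping.keys c \<subseteq> I" using assms(5) by simp
  then show ?thesis
  proof (induction rule: free_Abelian_group_induct[consumes 1, case_names zero diff gen])
    case zero
    show ?case using g.hom_one h.hom_one by simp
  next
    case (diff x y)
    have k_diff: "k (x - y) = k x \<otimes>\<^bsub>H\<^esub> inv\<^bsub>H\<^esub> k y" if "group_hom (free_Abelian_group I) H k" for k
    proof -
      interpret k: group_hom "free_Abelian_group I" H k by (rule that)
      show ?thesis using diff k.hom_mult[of x "- y"] k.hom_inv[of y] by simp
    qed
    show ?case
      using diff k_diff[OF g.group_hom_axioms] k_diff[OF h.group_hom_axioms] by simp
  qed (rule assms)
qed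


section \<open>Evaluation of words\<close>

lemma eval_word_closed:
  assumes "group K" "f \<in> X \<rightarrow> carrier K" "u \<in> words X"
  shows "eval_word K f u \<in> carrier K"
proof -
  interpret group K by (rule assms)
  show ?thesis using assms(2,3) by (induction u) (auto simp: Pi_iff)
qed

lemma eval_word_append:
  assumes "group K" "f \<in> X \<rightarrow> carrier K" "u \<in> words X" "v \<in> words X"
  shows "eval_word K f (u @ v) = eval_word K f u \<otimes>\<^bsub>K\<^esub> eval_word K f v"
proof -
  interpret group K by (rule assms)
  show ?thesis using assms(2-4)
    by (induction u) (auto simp: Pi_iff m_assoc eval_word_closed[OF assms(1,2)])
qed

lemma hom_eval_word:
  assumes "group H" "group K" "h \<in> hom H K" "f \<in> X \<rightarrow> carrier H" "u \<in> words X"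
    and "\<And>x. x \<in> X \<Longrightarrow> h (f x) = g x"
  shows "h (eval_word H f u) = eval_word K g u"
proof -
  interpret group_hom H K h using assms by (simp add: group_hom_def group_hom_axioms_def)
  show ?thesis using assms(4-6)
    by (induction u) (auto simp: Pi_iff eval_word_closed[OF assms(1,4)])
qed

text \<open>The witness is the reversed word with every exponent flipped. Values of words are thus
  closed under inverses, as \<open>eval_\<delta>_surj\<close> requires.\<close>

lemma inv_eval_word:
  assumes "group K" "f \<in> X \<rightarrow> carrier K" "u \<in> words X"
  shows "\<exists>v \<in> words X. inv\<^bsub>K\<^esub> eval_word K f u = eval_word K f v"
  using assms(3)
proof (induction u)
  case Nil
  interpret group K by (rule assms)
  show ?case by (auto intro!: bexI[of _ "[]"])
next
  case (Cons p u)
  interpret group K by (rule assms)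
  obtain x b where p: "p = (x, b)" by (cases p)
  obtain v where v: "v \<in> words X" "inv\<^bsub>K\<^esub> eval_word K f u = eval_word K f v"
    using Cons by auto
  have "f x \<in> carrier K" using Cons.prems assms(2) by (auto simp: p)
  then have "inv\<^bsub>K\<^esub> eval_word K f (p # u) = eval_word K f (v @ [(x, \<not> b)])"
    using Cons.prems v eval_word_closed[OF assms(1,2), of u]
    by (simp add: p inv_mult_group eval_word_append[OF assms(1,2)])
  moreover have "v @ [(x, \<not> b)] \<in> words X" using v Cons.prems by (simp add: p)
  ultimately show ?case by blast
qed

lemma eval_word_replicate:
  assumes "group K" "f a \<in> carrier K"
  shows "eval_word K f (replicate k (a, True)) = f a [^]\<^bsub>K\<^esub> k"
proof -
  interpret group K by (rule assms)
  show ?thesis using assms(2) by (induction k) (auto simp flip: nat_pow_Suc2)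
qed

lemma eval_word_presented_group:
  assumes "u \<in> words X"
  shows "eval_word (presented_group X R) (\<lambda>x. word_class X R [(x, True)]) u = word_class X R u"
  using assms
proof (induction u)
  case (Cons p u)
  let ?P = "presented_group X R"
  interpret group ?P by (rule group_presented_group)
  obtain x b where p: "p = (x, b)" by (cases p)
  have car: "word_class X R v \<in> carrier ?P" if "v \<in> words X" for v
    using that by (simp add: presented_group_def)
  \<comment> \<open>The cancellation relation identifies the class of a formal inverse letter with
    the actual group inverse.\<close>
  have "word_class X R [(x, False)] \<otimes>\<^bsub>?P\<^esub> word_class X R [(x, True)] = \<one>\<^bsub>?P\<^esub>"
    using Cons.prems word_eq.cancel[of x X R False]
    by (simp add: p presented_group_mult word_class_eq_iff) (simp add: presented_group_def word_class_eq_iff)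
  then have "inv\<^bsub>?P\<^esub> word_class X R [(x, True)] = word_class X R [(x, False)]"
    using Cons.prems by (intro inv_equality car) (simp_all add: p)
  then show ?case
    using Cons presented_group_mult[of "[(x, b)]" X u R] by (cases b) (simp_all add: p)
qed (simp add: presented_group_def)


section \<open>Conjugacy classes\<close>

lemma (in group) conj_class_self: "a \<in> carrier G \<Longrightarrow> a \<in> conj_class G a"
  unfolding conj_class_def by (auto intro!: exI[of _ "\<one>"])

lemma (in group) conj_class_sym:
  assumes "a \<in> carrier G" "b \<in> conj_class G a"
  shows "a \<in> conj_class G b"
proof -
  from assms obtain g where g: "g \<in> carrier G" "b = inv g \<otimes> a \<otimes> g" by (auto simp: conj_class_def)
  have "a = inv (inv g) \<otimes> b \<otimes> inv g"
    using g assms(1) by (simp add: m_assoc) (simp flip: m_assoc)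
  with g show ?thesis unfolding conj_class_def by blast
qed

lemma (in group) conj_class_eq:
  assumes "a \<in> carrier G" "b \<in> conj_class G a"
  shows "conj_class G b = conj_class G a"
proof -
  have sub: "conj_class G y \<subseteq> conj_class G x" if "x \<in> carrier G" "y \<in> conj_class G x" for x y
    using conj_class_conj[OF that] by (auto simp: conj_class_def[of G y])
  have "b \<in> carrier G" using assms conj_class_closed by blast
  with sub assms conj_class_sym show ?thesis by blast
qed

lemma (in group) conj_class_of_conj:
  assumes "a \<in> carrier G" "g \<in> carrier G"
  shows "conj_class G (inv g \<otimes> a \<otimes> g) = conj_class G a"
  by (rule conj_class_eq[OF assms(1) conj_class_conj[OF assms(1) conj_class_self[OF assms(1)] assms(2)]])

text \<open>Because this is an equivalence, the indicator of a class is invariant under conjugation,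
  so it respects the relations of a structure group.\<close>

lemma (in group) conj_class_conj_iff:
  assumes "a \<in> carrier G" "b \<in> carrier G" "g \<in> carrier G"
  shows "inv g \<otimes> b \<otimes> g \<in> conj_class G a \<longleftrightarrow> b \<in> conj_class G a"
proof
  assume *: "inv g \<otimes> b \<otimes> g \<in> conj_class G a"
  have "inv g \<otimes> b \<otimes> g \<in> conj_class G b" using assms by (auto simp: conj_class_def)
  from conj_class_sym[OF assms(2) this] conj_class_eq[OF assms(1) *]
  show "b \<in> conj_class G a" by simp
qed (use assms conj_class_conj in blast)


section \<open>The structure group of a union of conjugacy classes\<close>

locale dehn = group G for G (structure) +
  fixes \<Gamma> :: "'a set"
  assumes gens_closed: "\<Gamma> \<subseteq> carrier G"
begin

definition S :: "'a set" where "S = (\<Union>a\<in>\<Gamma>. conj_class G a)"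

abbreviation D :: "'a word set monoid" where "D \<equiv> Dehn_group G \<Gamma>"

text \<open>The quandle operation is unfolded to conjugation in \<open>G\<close>, which makes
  \<open>D\<close> literally \<open>presented_group S rels\<close>.\<close>

definition rels :: "('a word \<times> 'a word) set" where
  "rels = {([(a, True), (b, True)], [(b, True), (inv b \<otimes> a \<otimes> b, True)]) | a b. a \<in> S \<and> b \<in> S}"

definition d :: "'a \<Rightarrow> 'a word set" where "d a = word_class S rels [(a, True)]"

lemma Dehn_group_eq: "D = presented_group S rels"
  by (simp add: Dehn_group_def As_def Dehn_quandle_def Conj_def S_def rels_def)

sublocale D: group D
  unfolding Dehn_group_eq by (rule group_presented_group)

lemma S_carrier: "a \<in> S \<Longrightarrow> a \<in> carrier G"
  using gens_closed conj_class_closed by (auto simp: S_def)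

lemma S_conj: "a \<in> S \<Longrightarrow> g \<in> carrier G \<Longrightarrow> inv g \<otimes> a \<otimes> g \<in> S"
  using gens_closed conj_class_conj unfolding S_def by blast

lemma d_closed [simp]: "a \<in> S \<Longrightarrow> d a \<in> carrier D"
  by (simp add: d_def Dehn_group_eq presented_group_def)

lemma d_rel: "a \<in> S \<Longrightarrow> b \<in> S \<Longrightarrow> d a \<otimes>\<^bsub>D\<^esub> d b = d b \<otimes>\<^bsub>D\<^esub> d (inv b \<otimes> a \<otimes> b)"
  using S_conj[of a b] S_carrier[of b]
  by (auto simp: d_def Dehn_group_eq presented_group_mult word_class_eq_iff rels_def intro!: word_eq.rel)

text \<open>Source of all the homomorphisms out of structure groups below: \<open>proj\<close>,
  \<open>count\<close>, the map from \<open>D\<close> to \<open>A(G)\<close>, and the map from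
  \<open>A(G)\<close> to the direct product.\<close>

lemma Dehn_group_universal:
  assumes "group K" "f \<in> S \<rightarrow> carrier K"
    and "\<And>a b. a \<in> S \<Longrightarrow> b \<in> S \<Longrightarrow> f a \<otimes>\<^bsub>K\<^esub> f b = f b \<otimes>\<^bsub>K\<^esub> f (inv b \<otimes> a \<otimes> b)"
  shows "\<exists>h \<in> hom D K. \<forall>a\<in>S. h (d a) = f a"
proof -
  interpret K: group K by (rule assms)
  have "\<exists>h \<in> hom D K. \<forall>u \<in> words S. h (word_class S rels u) = eval_word K f u"
    unfolding Dehn_group_eq
  proof (rule presented_group_universal[OF assms(1,2)])
    show "eval_word K f l = eval_word K f r" if "(l, r) \<in> rels" for l r
    proof -
      from that obtain a b where "a \<in> S" "b \<in> S" "l = [(a, True), (b, True)]"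
        "r = [(b, True), (inv b \<otimes> a \<otimes> b, True)]"
        by (auto simp: rels_def)
      then show ?thesis
        using assms(2,3) S_conj[of a b] S_carrier[of b] by (auto simp: Pi_iff)
    qed
  qed
  then obtain h where h: "h \<in> hom D K" "\<And>u. u \<in> words S \<Longrightarrow> h (word_class S rels u) = eval_word K f u"
    by blast
  have "h (d a) = f a" if "a \<in> S" for a
    using h(2)[of "[(a, True)]"] that assms(2) by (auto simp: d_def Pi_iff)
  with h(1) show ?thesis by blast
qed

text \<open>Each element is the class of a word, and this class equals the value of the word at the
  generators \<open>d a\<close>. Letters may be formal inverses, hence the case
  \<open>inv\<close>.\<close>

lemma Dehn_group_induct [consumes 1, case_names one gen inv mult]:
  assumes x: "x \<in> carrier D" and one: "P \<one>\<^bsub>D\<^esub>" and gen: "\<And>a. a \<in> S \<Longrightarrow> P (d a)"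
    and inv: "\<And>x. x \<in> carrier D \<Longrightarrow> P x \<Longrightarrow> P (inv\<^bsub>D\<^esub> x)"
    and mult: "\<And>x y. x \<in> carrier D \<Longrightarrow> y \<in> carrier D \<Longrightarrow> P x \<Longrightarrow> P y \<Longrightarrow> P (x \<otimes>\<^bsub>D\<^esub> y)"
  shows "P x"
proof -
  have "P (eval_word D d u)" if "u \<in> words S" for u
    using that
  proof (induction u)
    case (Cons p u)
    then show ?case
      using eval_word_closed[OF D.is_group, of d S u] by (auto intro!: mult gen inv)
  qed (simp add: one)
  moreover obtain u where "u \<in> words S" "x = word_class S rels u"
    using x by (auto simp: Dehn_group_eq presented_group_def)
  moreover have "eval_word D d u = word_class S rels u" if "u \<in> words S" for u
    using eval_word_presented_group[OF that, of rels] by (simp add: Dehn_group_eq d_def[abs_def])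
  ultimately show ?thesis by metis
qed

lemma hom_Dehn_group_eqI:
  assumes "group H" "g \<in> hom D H" "h \<in> hom D H" "\<And>a. a \<in> S \<Longrightarrow> g (d a) = h (d a)"
    and "x \<in> carrier D"
  shows "g x = h x"
proof -
  interpret g: group_hom D H g using assms by (simp add: group_hom_def group_hom_axioms_def)
  interpret h: group_hom D H h using assms by (simp add: group_hom_def group_hom_axioms_def)
  show ?thesis
    using assms(5) by (induction rule: Dehn_group_induct) (simp_all add: assms(4))
qed

section \<open>The projection to \<open>G\<close> and its central kernel\<close>

definition proj :: "'a word set \<Rightarrow> 'a" where
  "proj = (SOME h. h \<in> hom D G \<and> (\<forall>a\<in>S. h (d a) = a))"

lemma proj: "proj \<in> hom D G \<and> (\<forall>a\<in>S. proj (d a) = a)"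
proof -
  have "\<exists>h \<in> hom D G. \<forall>a\<in>S. h (d a) = a"
  proof (rule Dehn_group_universal)
    show "a \<otimes> b = b \<otimes> (inv b \<otimes> a \<otimes> b)" if "a \<in> S" "b \<in> S" for a b
      using that S_carrier by (simp flip: m_assoc)
  qed (auto simp: S_carrier is_group)
  then show ?thesis unfolding proj_def Bex_def by (rule someI_ex)
qed

sublocale proj: group_hom D G proj
  using proj by unfold_locales simp

lemma proj_d [simp]: "a \<in> S \<Longrightarrow> proj (d a) = a"
  using proj by simp

text \<open>For a generator \<open>w = d b\<close> this is the defining relation; products and
  inverses follow by induction on \<open>w\<close>. Hence \<open>D\<close> acts on its generators
  through \<open>proj\<close> alone.\<close>

lemma conj_d:
  assumes "w \<in> carrier D" "a \<in> S"
  shows "inv\<^bsub>D\<^esub> w \<otimes>\<^bsub>D\<^esub> d a \<otimes>\<^bsub>D\<^esub> w = d (inv (proj w) \<otimes> a \<otimes> proj w)"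
  using assms
proof (induction arbitrary: a rule: Dehn_group_induct)
  case one
  then show ?case using S_carrier by simp
next
  case (gen b)
  then show ?case
    using d_rel[of a b] S_conj[of a b] S_carrier[of b]
    by (simp add: D.m_assoc) (simp flip: D.m_assoc)
next
  case (inv w)
  have p: "proj w \<in> carrier G" using inv by simp
  \<comment> \<open>\<open>a'\<close> is chosen so that conjugation by \<open>proj w\<close> carries
    it to \<open>a\<close>. The induction hypothesis at \<open>a'\<close> is then solved for
    \<open>d a'\<close>.\<close>
  define a' where "a' = proj w \<otimes> a \<otimes> inv (proj w)"
  have a': "a' \<in> S" using S_conj[OF inv.prems, of "inv (proj w)"] p by (simp add: a'_def)
  have a: "inv (proj w) \<otimes> a' \<otimes> proj w = a"
    using p S_carrier[OF inv.prems] by (simp add: a'_def m_assoc) (simp flip: m_assoc)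
  have "d a = inv\<^bsub>D\<^esub> w \<otimes>\<^bsub>D\<^esub> d a' \<otimes>\<^bsub>D\<^esub> w" using inv.IH[OF a'] a by simp
  then have "w \<otimes>\<^bsub>D\<^esub> d a \<otimes>\<^bsub>D\<^esub> inv\<^bsub>D\<^esub> w = d a'"
    using inv.hyps a' by (simp add: D.m_assoc) (simp flip: D.m_assoc)
  then show ?case using inv.hyps by (simp add: a'_def)
next
  case (mult v w)
  have "inv\<^bsub>D\<^esub> (v \<otimes>\<^bsub>D\<^esub> w) \<otimes>\<^bsub>D\<^esub> d a \<otimes>\<^bsub>D\<^esub> (v \<otimes>\<^bsub>D\<^esub> w)
      = inv\<^bsub>D\<^esub> w \<otimes>\<^bsub>D\<^esub> (inv\<^bsub>D\<^esub> v \<otimes>\<^bsub>D\<^esub> d a \<otimes>\<^bsub>D\<^esub> v) \<otimes>\<^bsub>D\<^esub> w"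
    using mult.hyps mult.prems by (simp add: D.inv_mult_group D.m_assoc)
  also have "\<dots> = d (inv (proj w) \<otimes> (inv (proj v) \<otimes> a \<otimes> proj v) \<otimes> proj w)"
    using mult S_conj[of a "proj v"] by simp
  also have "inv (proj w) \<otimes> (inv (proj v) \<otimes> a \<otimes> proj v) \<otimes> proj w
      = inv (proj (v \<otimes>\<^bsub>D\<^esub> w)) \<otimes> a \<otimes> proj (v \<otimes>\<^bsub>D\<^esub> w)"
    using mult.hyps S_carrier[OF mult.prems] by (simp add: inv_mult_group m_assoc)
  finally show ?case .
qed

text \<open>By \<open>conj_d\<close>, conjugation by \<open>z\<close> fixes every generator, and
  elements commuting with \<open>z\<close> are closed under products and inverses.\<close>

lemma proj_kernel_center:
  assumes z: "z \<in> carrier D" "proj z = \<one>"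
  shows "z \<in> center D"
proof -
  have "z \<otimes>\<^bsub>D\<^esub> x = x \<otimes>\<^bsub>D\<^esub> z" if "x \<in> carrier D" for x
    using that
  proof (induction rule: Dehn_group_induct)
    case (gen a)
    then have "inv\<^bsub>D\<^esub> z \<otimes>\<^bsub>D\<^esub> d a \<otimes>\<^bsub>D\<^esub> z = d a"
      using conj_d[OF z(1) gen] z S_carrier by simp
    then have "z \<otimes>\<^bsub>D\<^esub> d a = z \<otimes>\<^bsub>D\<^esub> (inv\<^bsub>D\<^esub> z \<otimes>\<^bsub>D\<^esub> d a \<otimes>\<^bsub>D\<^esub> z)" by simp
    also have "\<dots> = d a \<otimes>\<^bsub>D\<^esub> z" using z gen by (simp flip: D.m_assoc)
    finally show ?case .
  next
    case (inv x)
    then show ?case using z D.inv_commute[of x z] by simp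
  next
    case (mult x y)
    have "z \<otimes>\<^bsub>D\<^esub> (x \<otimes>\<^bsub>D\<^esub> y) = z \<otimes>\<^bsub>D\<^esub> x \<otimes>\<^bsub>D\<^esub> y" using z(1) mult.hyps by (simp add: D.m_assoc)
    also have "\<dots> = x \<otimes>\<^bsub>D\<^esub> (z \<otimes>\<^bsub>D\<^esub> y)"
      using z(1) mult.hyps by (simp add: D.m_assoc mult.IH(1))
    also have "\<dots> = x \<otimes>\<^bsub>D\<^esub> y \<otimes>\<^bsub>D\<^esub> z"
      using z(1) mult.hyps by (simp add: D.m_assoc mult.IH(2))
    finally show ?case .
  qed (use z in simp)
  with z show ?thesis by (simp add: center_def)
qed

section \<open>Class counts as homomorphisms to the integers\<close>

definition count :: "'a \<Rightarrow> 'a word set \<Rightarrow> int" where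
  "count c = (SOME h. h \<in> hom D integer_group \<and> (\<forall>a\<in>S. h (d a) = (if a \<in> conj_class G c then 1 else 0)))"

text \<open>\<open>count c\<close> is the exponent sum of the generators lying in the class of
  \<open>c\<close>. A relation of \<open>D\<close> only replaces a generator by a conjugate and
  reorders letters, which leaves this sum unchanged.\<close>

lemma count:
  assumes "c \<in> carrier G"
  shows "count c \<in> hom D integer_group \<and> (\<forall>a\<in>S. count c (d a) = (if a \<in> conj_class G c then 1 else 0))"
proof -
  have "\<exists>h \<in> hom D integer_group. \<forall>a\<in>S. h (d a) = (if a \<in> conj_class G c then 1 else 0)"
    by (rule Dehn_group_universal) (use assms S_carrier conj_class_conj_iff in auto)
  then show ?thesis unfolding count_def Bex_def by (rule someI_ex)
qed

lemma count_hom: "c \<in> carrier G \<Longrightarrow> group_hom D integer_group (count c)"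
  using count by (simp add: group_hom_def group_hom_axioms_def)

lemma count_d: "c \<in> carrier G \<Longrightarrow> a \<in> S \<Longrightarrow> count c (d a) = (if a \<in> conj_class G c then 1 else 0)"
  using count by simp

text \<open>The target is commutative, so the contributions of \<open>w\<close> and its inverse
  cancel.\<close>

lemma count_conj:
  assumes "c \<in> carrier G" "x \<in> carrier D" "w \<in> carrier D"
  shows "count c (inv\<^bsub>D\<^esub> w \<otimes>\<^bsub>D\<^esub> x \<otimes>\<^bsub>D\<^esub> w) = count c x"
proof -
  interpret c: group_hom D integer_group "count c" by (rule count_hom[OF assms(1)])
  show ?thesis using assms c.hom_inv[of w] by simp
qed

end

section \<open>Groups with a \<open>C\<close>-bar-type presentation\<close>

locale cbar = group G for G (structure) +
  fixes X :: "'x set" and R :: "('x word \<times> 'x word) set" and \<iota> :: "'x \<Rightarrow> 'a"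
  assumes cbar: "Cbar_presentation G X R \<iota>"
begin

section \<open>Words over the presentation, evaluated in \<open>G\<close> and in
  \<open>D\<close>\<close>

lemma ex_iso:
  "\<exists>\<phi> \<in> iso (presented_group X R) G. \<forall>x\<in>X. \<phi> (word_class X R [(x, True)]) = \<iota> x"
  using cbar by (simp add: Cbar_presentation_def is_presentation_def)

lemma gen_closed: "x \<in> X \<Longrightarrow> \<iota> x \<in> carrier G"
proof -
  assume x: "x \<in> X"
  obtain \<phi> where "\<phi> \<in> iso (presented_group X R) G" "\<forall>x\<in>X. \<phi> (word_class X R [(x, True)]) = \<iota> x"
    using ex_iso by blast
  moreover have "word_class X R [(x, True)] \<in> carrier (presented_group X R)"
    using x by (simp add: presented_group_def)
  ultimately show ?thesis using x by (metis hom_in_carrier iso_imp_homomorphism)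
qed

sublocale dehn G "\<iota> ` X"
  by unfold_locales (auto simp: gen_closed)

lemma ex_iso_eval:
  "\<exists>\<phi> \<in> iso (presented_group X R) G. \<forall>u\<in>words X. \<phi> (word_class X R u) = eval_word G \<iota> u"
proof -
  obtain \<phi> where \<phi>: "\<phi> \<in> iso (presented_group X R) G" "\<forall>x\<in>X. \<phi> (word_class X R [(x, True)]) = \<iota> x"
    using ex_iso by blast
  have "\<phi> (word_class X R u) = eval_word G \<iota> u" if "u \<in> words X" for u
    using hom_eval_word[OF group_presented_group is_group iso_imp_homomorphism[OF \<phi>(1)] _ that,
        of "\<lambda>x. word_class X R [(x, True)]" \<iota>] \<phi>(2)
    by (simp add: eval_word_presented_group[OF that]) (simp add: presented_group_def Pi_iff)
  with \<phi>(1) show ?thesis by blast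
qed

text \<open>Injectivity of the isomorphism from the presented group: an equality in \<open>G\<close>
  between values of words can be derived from the relations in \<open>R\<close>. Derivations can
  then be replayed in \<open>D\<close>.\<close>

lemma word_eq_iff_eval:
  assumes "u \<in> words X" "v \<in> words X"
  shows "word_eq X R u v \<longleftrightarrow> eval_word G \<iota> u = eval_word G \<iota> v"
proof -
  obtain \<phi> where \<phi>: "\<phi> \<in> iso (presented_group X R) G" "\<forall>u\<in>words X. \<phi> (word_class X R u) = eval_word G \<iota> u"
    using ex_iso_eval by blast
  have "inj_on \<phi> (carrier (presented_group X R))" using \<phi>(1) by (simp add: iso_def bij_betw_def)
  then have "\<phi> (word_class X R u) = \<phi> (word_class X R v) \<longleftrightarrow> word_class X R u = word_class X R v"
    by (rule inj_on_eq_iff) (use assms in \<open>simp_all add: presented_group_def\<close>)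
  then show ?thesis using assms \<phi>(2) by (simp add: word_class_eq_iff)
qed

lemma eval_surj:
  assumes "g \<in> carrier G"
  obtains u where "u \<in> words X" "eval_word G \<iota> u = g"
proof -
  obtain \<phi> where \<phi>: "\<phi> \<in> iso (presented_group X R) G" "\<forall>u\<in>words X. \<phi> (word_class X R u) = eval_word G \<iota> u"
    using ex_iso_eval by blast
  have "g \<in> \<phi> ` carrier (presented_group X R)" using \<phi>(1) assms by (auto simp: iso_def bij_betw_def)
  then show thesis using \<phi>(2) that by (auto simp: presented_group_def)
qed

text \<open>Indexed by names in \<open>X\<close> rather than by elements of \<open>G\<close>, so
  that one word can be evaluated both in \<open>G\<close>, via \<open>\<iota>\<close>, and in
  \<open>D\<close>.\<close>

definition \<delta> :: "'x \<Rightarrow> 'a word set" where "\<delta> x = d (\<iota> x)"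

lemma gen_S: "x \<in> X \<Longrightarrow> \<iota> x \<in> S"
  using gen_closed conj_class_self by (auto simp: S_def)

lemma \<delta>_Pi: "\<delta> \<in> X \<rightarrow> carrier D"
  by (simp add: \<delta>_def gen_S)

lemmas eval_\<delta>_closed [simp] = eval_word_closed[OF D.is_group \<delta>_Pi]
lemmas eval_\<delta>_append = eval_word_append[OF D.is_group \<delta>_Pi]

lemma proj_eval: "u \<in> words X \<Longrightarrow> proj (eval_word D \<delta> u) = eval_word G \<iota> u"
  using hom_eval_word[OF D.is_group is_group proj.homh \<delta>_Pi] by (simp add: \<delta>_def gen_S)

lemma proj_surj:
  assumes "g \<in> carrier G"
  obtains x where "x \<in> carrier D" "proj x = g"
  using eval_surj[OF assms] proj_eval eval_\<delta>_closed by metis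

text \<open>\<open>D\<close> has a generator for every conjugate of some \<open>\<iota> x\<close>.
  If the word \<open>u\<close> evaluates to \<open>g\<close> in \<open>G\<close>, its value in
  \<open>D\<close> lies over \<open>g\<close>, and by \<open>conj_d\<close> it conjugates
  \<open>\<delta> x\<close> to the generator of the conjugate by \<open>g\<close>.\<close>

lemma eval_\<delta>_surj:
  assumes "x \<in> carrier D"
  shows "\<exists>u \<in> words X. x = eval_word D \<delta> u"
  using assms
proof (induction rule: Dehn_group_induct)
  case one
  show ?case by (auto intro!: bexI[of _ "[]"])
next
  case (gen a)
  then obtain x g where x: "x \<in> X" "g \<in> carrier G" "a = inv g \<otimes> \<iota> x \<otimes> g"
    by (auto simp: S_def conj_class_def)
  obtain u where u: "u \<in> words X" "eval_word G \<iota> u = g" using eval_surj[OF x(2)] .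
  obtain v where v: "v \<in> words X" "inv\<^bsub>D\<^esub> eval_word D \<delta> u = eval_word D \<delta> v"
    using inv_eval_word[OF D.is_group \<delta>_Pi u(1)] by blast
  have "d a = inv\<^bsub>D\<^esub> eval_word D \<delta> u \<otimes>\<^bsub>D\<^esub> \<delta> x \<otimes>\<^bsub>D\<^esub> eval_word D \<delta> u"
    using conj_d[of "eval_word D \<delta> u" "\<iota> x"] x u by (simp add: gen_S proj_eval \<delta>_def)
  also have "\<dots> = eval_word D \<delta> (v @ [(x, True)] @ u)"
    using x u(1) v gen_S[OF x(1)] by (simp add: eval_\<delta>_append D.m_assoc \<delta>_def)
  finally have "d a = eval_word D \<delta> (v @ [(x, True)] @ u)" .
  moreover have "v @ [(x, True)] @ u \<in> words X" using u v x by simp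
  ultimately show ?case by blast
next
  case (inv x)
  then show ?case using inv_eval_word[OF D.is_group \<delta>_Pi] by metis
next
  case (mult x y)
  then obtain u v where "u \<in> words X" "x = eval_word D \<delta> u" "v \<in> words X" "y = eval_word D \<delta> v" by blast
  then show ?case by (intro bexI[of _ "u @ v"]) (simp_all add: eval_\<delta>_append)
qed

section \<open>Power relations and the kernel of \<open>proj\<close>\<close>

definition powers :: "('x \<times> nat) set" where "powers = {(a, k). power_relation a k \<in> R}"

lemma R_cases:
  assumes "(l, r) \<in> R"
  obtains (conj) a b c where "a \<in> X" "b \<in> X" "c \<in> X" "(l, r) = conj_relation a b c"
  | (power) a k where "(a, k) \<in> powers" "(l, r) = power_relation a k"
  using assms cbar by (auto simp: Cbar_presentation_def powers_def)

text \<open>A conjugation relation has a nonempty right side, so the pair must be a power relation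
  with exponent at least 2; its left side is nonempty and determines both \<open>a\<close> and
  \<open>k\<close>.\<close>

lemma powersD:
  assumes "(a, k) \<in> powers"
  shows "a \<in> X" "k > 0"
proof -
  have R: "power_relation a k \<in> R" using assms by (simp add: powers_def)
  then consider (c) b c e where "power_relation a k = conj_relation b c e"
    | (p) b j where "b \<in> X" "j \<ge> 2" "power_relation a k = power_relation b j"
    using cbar by (auto simp: Cbar_presentation_def)
  then have "a \<in> X \<and> k > 0"
  proof cases
    case c
    then show ?thesis by (simp add: power_relation_def conj_relation_def)
  next
    case p
    then show ?thesis by (auto simp: power_relation_def replicate_eq_replicate)
  qed
  then show "a \<in> X" "k > 0" by simp_all
qed

lemma powers_unique:
  assumes "(a, k) \<in> powers" "(b, j) \<in> powers" "\<iota> b \<in> conj_class G (\<iota> a)"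
  shows "(b, j) = (a, k)"
proof -
  have a: "\<iota> a \<in> carrier G" using assms powersD gen_closed by blast
  then have "conj_class G (\<iota> a) \<in> conj_classes G" by (simp add: conj_classes_def)
  then show ?thesis
    using cbar assms conj_class_self[OF a] unfolding Cbar_presentation_def powers_def by blast
qed

text \<open>The relation makes this power trivial in \<open>G\<close>, so it lies in the kernel of
  \<open>proj\<close>.\<close>

lemma power_center:
  assumes "(a, k) \<in> powers"
  shows "\<delta> a [^]\<^bsub>D\<^esub> k \<in> center D"
proof (rule proj_kernel_center)
  have a: "a \<in> X" using powersD assms by blast
  have w: "replicate k (a, True) \<in> words X" using a by (induction k) auto
  have "word_eq X R (replicate k (a, True)) []"
    using assms w by (intro word_eq.rel) (auto simp: powers_def power_relation_def)
  then have "eval_word G \<iota> (replicate k (a, True)) = \<one>" using word_eq_iff_eval[OF w, of "[]"] by simp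
  then show "proj (\<delta> a [^]\<^bsub>D\<^esub> k) = \<one>"
    using proj_eval[OF w] eval_word_replicate[OF D.is_group, of \<delta> a k] a by (simp add: \<delta>_def gen_S)
qed (use powersD assms in \<open>auto simp: \<delta>_def gen_S\<close>)

text \<open>An element over the identity is a product of the central powers
  \<open>\<delta> a [^] k\<close> and their inverses. Distinct power relations lie in distinct
  classes, so the counts read off every exponent; if all counts vanish, the product is
  trivial.\<close>

lemma eq_one_if_proj_count:
  assumes x: "x \<in> carrier D" "proj x = \<one>" and cnt: "\<And>c. c \<in> carrier G \<Longrightarrow> count c x = 0"
  shows "x = \<one>\<^bsub>D\<^esub>"
proof -
  have "(\<lambda>(a, k). \<delta> a [^]\<^bsub>D\<^esub> k) ` powers \<subseteq> center D" using power_center by auto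
  then obtain \<theta> where \<theta>: "\<theta> \<in> hom (free_Abelian_group powers) D"
    "\<And>p. p \<in> powers \<Longrightarrow> \<theta> (frag_of p) = (case p of (a, k) \<Rightarrow> \<delta> a [^]\<^bsub>D\<^esub> k)"
    "\<And>c. c \<in> carrier (free_Abelian_group powers) \<Longrightarrow> \<theta> c \<in> center D"
    by (rule D.free_Abelian_group_hom_center) blast
  let ?F = "free_Abelian_group powers"
  interpret \<theta>: group_hom ?F D \<theta>
    by (intro group_hom.intro group_hom_axioms.intro) (simp_all add: \<theta>(1))
  \<comment> \<open>A derivation from \<open>R\<close> is replayed in \<open>D\<close> up to a
    factor in the image of \<open>\<theta>\<close>. Centrality lets the factors be collected on the
    left when words are concatenated.\<close>
  have ev: "\<exists>c \<in> carrier ?F. eval_word D \<delta> u = \<theta> c \<otimes>\<^bsub>D\<^esub> eval_word D \<delta> v" if "word_eq X R u v" for u v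
    using that
  proof (induction rule: word_eq.induct)
    case (refl u)
    then show ?case using \<theta>.hom_one by (intro bexI[of _ 0]) simp_all
  next
    case (sym u v)
    then obtain c where c: "c \<in> carrier ?F" "eval_word D \<delta> u = \<theta> c \<otimes>\<^bsub>D\<^esub> eval_word D \<delta> v" by blast
    have uv: "u \<in> words X" "v \<in> words X" using word_eq_words[OF sym.hyps] by simp_all
    have "eval_word D \<delta> v = inv\<^bsub>D\<^esub> \<theta> c \<otimes>\<^bsub>D\<^esub> eval_word D \<delta> u"
      using c uv \<theta>.hom_closed[OF c(1)] by (simp flip: D.m_assoc)
    then show ?case using \<theta>.hom_inv[OF c(1)] \<theta>.G.inv_closed[OF c(1)] by metis
  next
    case (trans u v w)
    then obtain c c' where c: "c \<in> carrier ?F" "eval_word D \<delta> u = \<theta> c \<otimes>\<^bsub>D\<^esub> eval_word D \<delta> v"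
      "c' \<in> carrier ?F" "eval_word D \<delta> v = \<theta> c' \<otimes>\<^bsub>D\<^esub> eval_word D \<delta> w" by blast
    have w: "w \<in> words X" using word_eq_words[OF trans.hyps(2)] by simp
    have "eval_word D \<delta> u = \<theta> (c \<otimes>\<^bsub>?F\<^esub> c') \<otimes>\<^bsub>D\<^esub> eval_word D \<delta> w"
      unfolding \<theta>.hom_mult[OF c(1,3)] c(2) c(4)
      using w \<theta>.hom_closed[OF c(1)] \<theta>.hom_closed[OF c(3)] by (simp add: D.m_assoc)
    then show ?case using \<theta>.G.m_closed[OF c(1,3)] by blast
  next
    case (append u u' v v')
    then obtain c c' where c: "c \<in> carrier ?F" "eval_word D \<delta> u = \<theta> c \<otimes>\<^bsub>D\<^esub> eval_word D \<delta> u'"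
      "c' \<in> carrier ?F" "eval_word D \<delta> v = \<theta> c' \<otimes>\<^bsub>D\<^esub> eval_word D \<delta> v'" by blast
    have w: "u \<in> words X" "u' \<in> words X" "v \<in> words X" "v' \<in> words X"
      using word_eq_words[OF append.hyps(1)] word_eq_words[OF append.hyps(2)] by simp_all
    note t = \<theta>.hom_closed[OF c(1)] \<theta>.hom_closed[OF c(3)]
    have "eval_word D \<delta> (u @ v)
        = \<theta> c \<otimes>\<^bsub>D\<^esub> (eval_word D \<delta> u' \<otimes>\<^bsub>D\<^esub> \<theta> c') \<otimes>\<^bsub>D\<^esub> eval_word D \<delta> v'"
      unfolding eval_\<delta>_append[OF w(1,3)] c(2) c(4) using w t by (simp add: D.m_assoc)
    also have "eval_word D \<delta> u' \<otimes>\<^bsub>D\<^esub> \<theta> c' = \<theta> c' \<otimes>\<^bsub>D\<^esub> eval_word D \<delta> u'"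
      by (rule center_commute[OF \<theta>(3)[OF c(3)], symmetric]) (use w in simp)
    also have "\<theta> c \<otimes>\<^bsub>D\<^esub> (\<theta> c' \<otimes>\<^bsub>D\<^esub> eval_word D \<delta> u') \<otimes>\<^bsub>D\<^esub> eval_word D \<delta> v'
        = \<theta> (c \<otimes>\<^bsub>?F\<^esub> c') \<otimes>\<^bsub>D\<^esub> eval_word D \<delta> (u' @ v')"
      unfolding eval_\<delta>_append[OF w(2,4)] \<theta>.hom_mult[OF c(1,3)] using w t by (simp add: D.m_assoc)
    finally show ?case using \<theta>.G.m_closed[OF c(1,3)] by blast
  next
    case (cancel x b)
    then show ?case using \<theta>.hom_one gen_S[of x] by (intro bexI[of _ 0]) (cases b; simp add: \<delta>_def)+
  next
    case (rel l r)
    from rel(1) show ?case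
    proof (cases rule: R_cases)
      case (conj a b c)
      \<comment> \<open>A conjugation relation already holds in \<open>D\<close>, by
        \<open>conj_d\<close> for the element \<open>d (\<iota> b)\<close>, so its factor is
        trivial.\<close>
      have "eval_word G \<iota> l = eval_word G \<iota> r"
        using word_eq_iff_eval[OF rel(2,3)] word_eq.rel[OF rel] by simp
      then have "inv (\<iota> b) \<otimes> \<iota> a \<otimes> \<iota> b = \<iota> c"
        using conj gen_closed by (simp add: conj_relation_def m_assoc)
      then have "inv\<^bsub>D\<^esub> \<delta> b \<otimes>\<^bsub>D\<^esub> \<delta> a \<otimes>\<^bsub>D\<^esub> \<delta> b = \<delta> c"
        using conj_d[of "d (\<iota> b)" "\<iota> a"] conj gen_S by (simp add: \<delta>_def)
      then have "eval_word D \<delta> l = eval_word D \<delta> r"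
        using conj gen_S by (simp add: conj_relation_def \<delta>_def D.m_assoc)
      then show ?thesis using \<theta>.hom_one rel by (intro bexI[of _ 0]) simp_all
    next
      case (power a k)
      \<comment> \<open>A power relation contributes exactly its own basis element as
        factor.\<close>
      then have "\<theta> (frag_of (a, k)) = eval_word D \<delta> l" "r = []"
        using \<theta>(2)[OF power(1)] powersD[OF power(1)] gen_S
        by (simp_all add: power_relation_def eval_word_replicate[OF D.is_group] \<delta>_def)
      then show ?thesis using power rel by (intro bexI[of _ "frag_of (a, k)"]) simp_all
    qed
  qed
  obtain u where u: "u \<in> words X" "x = eval_word D \<delta> u" using eval_\<delta>_surj[OF x(1)] by blast
  then have "word_eq X R u []" using x(2) word_eq_iff_eval[OF u(1), of "[]"] proj_eval by simp
  from ev[OF this] obtain c where c: "c \<in> carrier ?F" "x = \<theta> c \<otimes>\<^bsub>D\<^esub> \<one>\<^bsub>D\<^esub>"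
    unfolding u(2) by auto
  then have xc: "x = \<theta> c" using \<theta>.hom_closed[OF c(1)] by simp
  have "poly_mapping.lookup c (a, k) = 0" if p: "(a, k) \<in> powers" for a k
  proof -
    have a: "a \<in> X" "\<iota> a \<in> carrier G" using powersD[OF p] gen_closed by blast+
    interpret n: group_hom D integer_group "count (\<iota> a)" by (rule count_hom[OF a(2)])
    \<comment> \<open>Counting the class of \<open>\<iota> a\<close> isolates one coefficient of
      \<open>c\<close>, scaled by \<open>k\<close>. Since \<open>k > 0\<close>, a vanishing count
      makes the coefficient vanish.\<close>
    have "(count (\<iota> a) \<circ> \<theta>) c = int k * poly_mapping.lookup c (a, k)"
    proof (rule hom_free_Abelian_group_eqI[OF group_integer_group _ _ _ c(1)])
      show "count (\<iota> a) \<circ> \<theta> \<in> hom ?F integer_group" by (rule Group.hom_compose[OF \<theta>(1) n.homh])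
      show "(\<lambda>c. int k * poly_mapping.lookup c (a, k)) \<in> hom ?F integer_group"
        by (rule homI) (simp_all add: lookup_add algebra_simps)
      fix q assume q: "q \<in> powers"
      obtain b j where bj: "q = (b, j)" by (cases q)
      have b: "b \<in> X" using powersD q bj by blast
      have "(count (\<iota> a) \<circ> \<theta>) (frag_of q) = int j * (if \<iota> b \<in> conj_class G (\<iota> a) then 1 else 0)"
        using \<theta>(2)[OF q] a b gen_S by (simp add: bj n.hom_nat_pow \<delta>_def count_d)
      also have "\<dots> = int k * poly_mapping.lookup (frag_of q) (a, k)"
      proof (cases "(b, j) = (a, k)")
        case True
        then show ?thesis using conj_class_self[OF a(2)] by (simp add: bj)
      next
        case False
        \<comment> \<open>Here the bound of one power relation per conjugacy class enters.\<close>
        then have "\<iota> b \<notin> conj_class G (\<iota> a)" using powers_unique[OF p] q bj by blast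
        with False show ?thesis by (auto simp: bj lookup_frag_of)
      qed
      finally show "(count (\<iota> a) \<circ> \<theta>) (frag_of q) = int k * poly_mapping.lookup (frag_of q) (a, k)" .
    qed
    then show ?thesis using cnt[OF a(2)] powersD(2)[OF p] xc by simp
  qed
  moreover have "poly_mapping.lookup c p = 0" if "p \<notin> powers" for p
    using c(1) that by (auto simp: in_keys_iff)
  ultimately have "c = 0" by (intro poly_mapping_eqI) (metis lookup_zero surj_pair)
  then show ?thesis using xc \<theta>.hom_one by simp
qed

text \<open>Apply \<open>eq_one_if_proj_count\<close> to the quotient of \<open>x\<close> by
  \<open>y\<close>.\<close>

lemma eq_if_proj_count:
  assumes "x \<in> carrier D" "y \<in> carrier D" "proj x = proj y"
    and "\<And>c. c \<in> carrier G \<Longrightarrow> count c x = count c y"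
  shows "x = y"
proof -
  have "x \<otimes>\<^bsub>D\<^esub> inv\<^bsub>D\<^esub> y = \<one>\<^bsub>D\<^esub>"
  proof (rule eq_one_if_proj_count)
    fix c assume c: "c \<in> carrier G"
    interpret c: group_hom D integer_group "count c" by (rule count_hom[OF c])
    show "count c (x \<otimes>\<^bsub>D\<^esub> inv\<^bsub>D\<^esub> y) = 0"
      using c.hom_mult[of x "inv\<^bsub>D\<^esub> y"] c.hom_inv[of y] assms c by simp
  qed (use assms in simp_all)
  then show ?thesis using assms D.inv_solve_right'[of "\<one>\<^bsub>D\<^esub>" x y] by simp
qed

section \<open>A conjugation-equivariant section of \<open>proj\<close>\<close>

lemma S_conj_iff:
  assumes "g \<in> carrier G" "h \<in> carrier G"
  shows "inv h \<otimes> g \<otimes> h \<in> S \<longleftrightarrow> g \<in> S"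
proof -
  have "inv h \<otimes> g \<otimes> h \<in> conj_class G (\<iota> x) \<longleftrightarrow> g \<in> conj_class G (\<iota> x)" if "x \<in> X" for x
    using conj_class_conj_iff[OF gen_closed[OF that] assms] .
  then show ?thesis by (simp add: S_def)
qed

text \<open>Lifting one representative of each class and conjugating is well defined: two conjugates of
  the lift over the same element of \<open>G\<close> have the same class counts, hence agree.\<close>

lemma equivariant_section:
  obtains \<sigma> where "\<And>g. g \<in> carrier G \<Longrightarrow> \<sigma> g \<in> carrier D" "\<And>g. g \<in> carrier G \<Longrightarrow> proj (\<sigma> g) = g"
    "\<And>g. g \<in> S \<Longrightarrow> \<sigma> g = d g"
    "\<And>g w. g \<in> carrier G \<Longrightarrow> w \<in> carrier D \<Longrightarrow>
       \<sigma> (inv (proj w) \<otimes> g \<otimes> proj w) = inv\<^bsub>D\<^esub> w \<otimes>\<^bsub>D\<^esub> \<sigma> g \<otimes>\<^bsub>D\<^esub> w"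
proof -
  define lift where "lift C = (SOME y. y \<in> carrier D \<and> proj y \<in> C)" for C
  have lift: "lift (conj_class G g) \<in> carrier D" "proj (lift (conj_class G g)) \<in> conj_class G g"
    if g: "g \<in> carrier G" for g
  proof -
    obtain x where "x \<in> carrier D" "proj x = g" using proj_surj[OF g] .
    then have "\<exists>y. y \<in> carrier D \<and> proj y \<in> conj_class G g" using conj_class_self[OF g] by blast
    from someI_ex[OF this] show "lift (conj_class G g) \<in> carrier D" "proj (lift (conj_class G g)) \<in> conj_class G g"
      by (simp_all add: lift_def)
  qed
  \<comment> \<open>The value over \<open>g\<close> is characterised by its counts rather than by a
    chosen conjugator, so uniqueness is immediate from \<open>eq_if_proj_count\<close>.\<close>
  define Q where "Q g y \<longleftrightarrow> y \<in> carrier D \<and> proj y = g \<and>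
    (\<forall>c\<in>carrier G. count c y = count c (lift (conj_class G g)))" for g y
  have Q_ex: "\<exists>y. Q g y" if g: "g \<in> carrier G" for g
  proof -
    let ?l = "lift (conj_class G g)"
    have "g \<in> conj_class G (proj ?l)" using conj_class_sym[OF g lift(2)[OF g]] .
    then obtain h where h: "h \<in> carrier G" "g = inv h \<otimes> proj ?l \<otimes> h" by (auto simp: conj_class_def)
    obtain w where w: "w \<in> carrier D" "proj w = h" using proj_surj[OF h(1)] .
    have "Q g (inv\<^bsub>D\<^esub> w \<otimes>\<^bsub>D\<^esub> ?l \<otimes>\<^bsub>D\<^esub> w)"
      using w lift(1)[OF g] h(2) by (auto simp: Q_def count_conj)
    then show ?thesis by blast
  qed
  have Q_unique: "y = z" if "Q g y" "Q g z" for g y z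
    using that by (intro eq_if_proj_count) (auto simp: Q_def)
  \<comment> \<open>The chosen lift of a class inside \<open>S\<close> need not be a generator, so
    \<open>d\<close> is prescribed there. As \<open>S\<close> is a union of classes, equivariance
    splits into two independent cases.\<close>
  define \<sigma> where "\<sigma> g = (if g \<in> S then d g else SOME y. Q g y)" for g
  have \<sigma>_Q: "Q g (\<sigma> g)" if "g \<in> carrier G" "g \<notin> S" for g
    using someI_ex[OF Q_ex[OF that(1)]] that by (simp add: \<sigma>_def)
  show thesis
  proof (rule that[of \<sigma>])
    show "\<sigma> g \<in> carrier D" "proj (\<sigma> g) = g" if "g \<in> carrier G" for g
      using that \<sigma>_Q[of g] by (cases "g \<in> S"; simp add: \<sigma>_def Q_def)+
    show "\<sigma> g = d g" if "g \<in> S" for g using that by (simp add: \<sigma>_def)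
    show "\<sigma> (inv (proj w) \<otimes> g \<otimes> proj w) = inv\<^bsub>D\<^esub> w \<otimes>\<^bsub>D\<^esub> \<sigma> g \<otimes>\<^bsub>D\<^esub> w"
      if "g \<in> carrier G" "w \<in> carrier D" for g w
    proof (cases "g \<in> S")
      case True
      then show ?thesis using conj_d[OF that(2) True] S_conj[OF True, of "proj w"] that by (simp add: \<sigma>_def)
    next
      case False
      let ?g = "inv (proj w) \<otimes> g \<otimes> proj w"
      have "?g \<notin> S" using S_conj_iff[of g "proj w"] False that by simp
      then have "Q ?g (\<sigma> ?g)" using \<sigma>_Q that by simp
      moreover have "conj_class G ?g = conj_class G g"
        using that by (intro conj_class_of_conj) simp_all
      \<comment> \<open>Conjugate elements share a class and hence the same chosen lift, while
        \<open>count_conj\<close> keeps the counts.\<close>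
      then have "Q ?g (inv\<^bsub>D\<^esub> w \<otimes>\<^bsub>D\<^esub> \<sigma> g \<otimes>\<^bsub>D\<^esub> w)"
        using \<sigma>_Q[OF that(1) False] that by (auto simp: Q_def count_conj)
      ultimately show ?thesis by (rule Q_unique)
    qed
  qed
qed

section \<open>The direct product decomposition of \<open>A(G)\<close>\<close>

lemma conj_class_nongen_iff:
  assumes "a \<in> carrier G"
  shows "conj_class G a \<in> nongen_classes G (\<iota> ` X) \<longleftrightarrow> a \<notin> S"
proof -
  have "a \<in> S \<longleftrightarrow> conj_class G a \<inter> \<iota> ` X \<noteq> {}"
  proof -
    have "a \<in> conj_class G (\<iota> x) \<longleftrightarrow> \<iota> x \<in> conj_class G a" if "x \<in> X" for x
      using conj_class_sym[OF assms] conj_class_sym[OF gen_closed[OF that]] by blast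
    then show ?thesis by (auto simp: S_def)
  qed
  then show ?thesis using assms by (auto simp: nongen_classes_def conj_classes_def)
qed

text \<open>A homomorphism \<open>\<psi>\<close> from the product multiplies the image of
  \<open>D\<close> by central elements indexed by the classes without generators. A homomorphism
  \<open>\<phi>\<close> built from the section satisfies \<open>\<phi> (\<psi> p) = p\<close>, and
  \<open>\<psi>\<close> hits all generators of \<open>A(G)\<close>.\<close>

lemma A_group_iso: "A_group G \<cong> D \<times>\<times> free_Abelian_group (nongen_classes G (\<iota> ` X))"
proof -
  \<comment> \<open>\<open>A(G)\<close> is the structure group for the generating set
    \<open>carrier G\<close>, so the results on \<open>D\<close> apply to it as well.\<close>
  interpret A: dehn G "carrier G" by unfold_locales simp
  have A_S: "A.S = carrier G"
    using conj_class_self conj_class_closed by (auto simp: A.S_def)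
  let ?A = "Dehn_group G (carrier G)"
  let ?N = "nongen_classes G (\<iota> ` X)"
  let ?F = "free_Abelian_group ?N"
  have A_eq: "A_group G = ?A" by (simp add: A_group_def Dehn_group_def Dehn_quandle_carrier)
  interpret F: comm_group ?F by (rule abelian_free_Abelian_group)
  interpret DF: group "D \<times>\<times> ?F" by (intro DirProd_group D.is_group F.is_group)
  obtain \<sigma> where \<sigma>: "\<And>g. g \<in> carrier G \<Longrightarrow> \<sigma> g \<in> carrier D" "\<And>g. g \<in> carrier G \<Longrightarrow> proj (\<sigma> g) = g"
    "\<And>g. g \<in> S \<Longrightarrow> \<sigma> g = d g"
    "\<And>g w. g \<in> carrier G \<Longrightarrow> w \<in> carrier D \<Longrightarrow>
       \<sigma> (inv (proj w) \<otimes> g \<otimes> proj w) = inv\<^bsub>D\<^esub> w \<otimes>\<^bsub>D\<^esub> \<sigma> g \<otimes>\<^bsub>D\<^esub> w"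
    by (rule equivariant_section) blast
  have "\<exists>h \<in> hom D ?A. \<forall>a\<in>S. h (d a) = A.d a"
  proof (rule Dehn_group_universal[OF A.D.is_group])
    show "A.d a \<otimes>\<^bsub>?A\<^esub> A.d b = A.d b \<otimes>\<^bsub>?A\<^esub> A.d (inv b \<otimes> a \<otimes> b)" if "a \<in> S" "b \<in> S" for a b
      using that by (intro A.d_rel) (simp_all add: A_S S_carrier)
  qed (simp add: A_S S_carrier)
  then obtain j where j: "j \<in> hom D ?A" "\<And>a. a \<in> S \<Longrightarrow> j (d a) = A.d a" by blast
  interpret j: group_hom D ?A j by unfold_locales (rule j)
  have proj_j: "A.proj (j x) = proj x" if "x \<in> carrier D" for x
    using hom_Dehn_group_eqI[OF is_group Group.hom_compose[OF j(1) A.proj.homh] proj.homh _ that]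
      S_carrier j(2) by (simp add: A_S)

  define r where "r C = (SOME x. x \<in> C)" for C :: "'a set"
  have r: "r C \<in> carrier G" "r C \<notin> S" "conj_class G (r C) = C" if C: "C \<in> ?N" for C
  proof -
    obtain a where a: "a \<in> carrier G" "C = conj_class G a"
      using C by (auto simp: nongen_classes_def conj_classes_def)
    then have "r C \<in> C" using conj_class_self[OF a(1)] someI[of "\<lambda>x. x \<in> C"] by (auto simp: r_def)
    then show rC: "r C \<in> carrier G" "conj_class G (r C) = C"
      using a conj_class_closed conj_class_eq[of a "r C"] by auto
    then show "r C \<notin> S" using conj_class_nongen_iff[OF rC(1)] C by simp
  qed
  \<comment> \<open>Both factors lie over \<open>r C\<close>, so \<open>z C\<close> projects to the
    identity of \<open>G\<close> and is therefore central.\<close>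
  define z where "z C = A.d (r C) \<otimes>\<^bsub>?A\<^esub> inv\<^bsub>?A\<^esub> j (\<sigma> (r C))" for C
  have "z ` ?N \<subseteq> center ?A"
  proof clarify
    fix C assume C: "C \<in> ?N"
    show "z C \<in> center ?A"
      by (rule A.proj_kernel_center) (use r[OF C] \<sigma>(1,2) in \<open>simp_all add: z_def A_S proj_j\<close>)
  qed
  then obtain \<theta> where \<theta>: "\<theta> \<in> hom ?F ?A" "\<And>C. C \<in> ?N \<Longrightarrow> \<theta> (frag_of C) = z C"
    "\<And>c. c \<in> carrier ?F \<Longrightarrow> \<theta> c \<in> center ?A"
    by (rule A.D.free_Abelian_group_hom_center) blast
  interpret \<theta>: group_hom ?F ?A \<theta> by unfold_locales (rule \<theta>)

  define \<psi> where "\<psi> = (\<lambda>(x, c). j x \<otimes>\<^bsub>?A\<^esub> \<theta> c)"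
  have \<psi>_hom: "\<psi> \<in> hom (D \<times>\<times> ?F) ?A"
  proof (rule homI)
    fix p q assume "p \<in> carrier (D \<times>\<times> ?F)" "q \<in> carrier (D \<times>\<times> ?F)"
    then obtain x c y e where pq: "p = (x, c)" "q = (y, e)" "x \<in> carrier D" "c \<in> carrier ?F"
      "y \<in> carrier D" "e \<in> carrier ?F" by (cases p, cases q) auto
    note cl = j.hom_closed[OF pq(3)] j.hom_closed[OF pq(5)] \<theta>.hom_closed[OF pq(4)] \<theta>.hom_closed[OF pq(6)]
    have "\<psi> (p \<otimes>\<^bsub>D \<times>\<times> ?F\<^esub> q) = j x \<otimes>\<^bsub>?A\<^esub> (j y \<otimes>\<^bsub>?A\<^esub> \<theta> c) \<otimes>\<^bsub>?A\<^esub> \<theta> e"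
      using cl pq(3,5) \<theta>.hom_mult[OF pq(4,6)] by (simp add: \<psi>_def pq(1,2) A.D.m_assoc)
    also have "j y \<otimes>\<^bsub>?A\<^esub> \<theta> c = \<theta> c \<otimes>\<^bsub>?A\<^esub> j y"
      by (rule center_commute[OF \<theta>(3)[OF pq(4)] cl(2), symmetric])
    also have "j x \<otimes>\<^bsub>?A\<^esub> (\<theta> c \<otimes>\<^bsub>?A\<^esub> j y) \<otimes>\<^bsub>?A\<^esub> \<theta> e = \<psi> p \<otimes>\<^bsub>?A\<^esub> \<psi> q"
      using cl by (simp add: \<psi>_def pq(1,2) A.D.m_assoc)
    finally show "\<psi> (p \<otimes>\<^bsub>D \<times>\<times> ?F\<^esub> q) = \<psi> p \<otimes>\<^bsub>?A\<^esub> \<psi> q" .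
  qed (use \<theta>.hom_closed in \<open>auto simp: \<psi>_def\<close>)
  interpret \<psi>: group_hom "D \<times>\<times> ?F" ?A \<psi> by unfold_locales (rule \<psi>_hom)

  \<comment> \<open>The second coordinate records the class of \<open>a\<close>; it is 0 on
    \<open>S\<close>, whose generators already come from \<open>D\<close>.\<close>
  define \<tau> where "\<tau> a = (\<sigma> a, if a \<in> S then 0 else frag_of (conj_class G a))" for a
  have "\<exists>h \<in> hom ?A (D \<times>\<times> ?F). \<forall>a\<in>A.S. h (A.d a) = \<tau> a"
  proof (rule A.Dehn_group_universal[OF DF.is_group])
    show "\<tau> \<in> A.S \<rightarrow> carrier (D \<times>\<times> ?F)"
      using \<sigma>(1) conj_class_nongen_iff by (auto simp: \<tau>_def A_S)
    fix a b assume "a \<in> A.S" "b \<in> A.S"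
    then have ab: "a \<in> carrier G" "b \<in> carrier G" by (simp_all add: A_S)
    have "conj_class G (inv b \<otimes> a \<otimes> b) = conj_class G a"
      using ab by (rule conj_class_of_conj)
    \<comment> \<open>Equivariance is applied to the element \<open>\<sigma> b\<close>, which lies
      over \<open>b\<close>.\<close>
    moreover have "\<sigma> (inv b \<otimes> a \<otimes> b) = inv\<^bsub>D\<^esub> \<sigma> b \<otimes>\<^bsub>D\<^esub> \<sigma> a \<otimes>\<^bsub>D\<^esub> \<sigma> b"
      using \<sigma>(4)[OF ab(1) \<sigma>(1)[OF ab(2)]] \<sigma>(2)[OF ab(2)] by simp
    moreover have "\<sigma> b \<otimes>\<^bsub>D\<^esub> (inv\<^bsub>D\<^esub> \<sigma> b \<otimes>\<^bsub>D\<^esub> \<sigma> a \<otimes>\<^bsub>D\<^esub> \<sigma> b) = \<sigma> a \<otimes>\<^bsub>D\<^esub> \<sigma> b"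
      using \<sigma>(1)[OF ab(1)] \<sigma>(1)[OF ab(2)] by (simp flip: D.m_assoc)
    ultimately show "\<tau> a \<otimes>\<^bsub>D \<times>\<times> ?F\<^esub> \<tau> b = \<tau> b \<otimes>\<^bsub>D \<times>\<times> ?F\<^esub> \<tau> (inv b \<otimes> a \<otimes> b)"
      using S_conj_iff[OF ab] by (simp add: \<tau>_def add.commute)
  qed
  then obtain \<phi> where \<phi>: "\<phi> \<in> hom ?A (D \<times>\<times> ?F)" "\<And>a. a \<in> carrier G \<Longrightarrow> \<phi> (A.d a) = \<tau> a"
    by (auto simp: A_S)
  interpret \<phi>: group_hom ?A "D \<times>\<times> ?F" \<phi> by unfold_locales (rule \<phi>)

  \<comment> \<open>On generators this is the normalisation \<open>\<sigma> a = d a\<close> for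
    \<open>a\<close> in \<open>S\<close>.\<close>
  have \<phi>_j: "(\<phi> \<circ> j) x = (x, 0)" if "x \<in> carrier D" for x
  proof (rule hom_Dehn_group_eqI[OF DF.is_group Group.hom_compose[OF j(1) \<phi>(1)] _ _ that])
    show "(\<lambda>x. (x, 0)) \<in> hom D (D \<times>\<times> ?F)" by (rule homI) simp_all
  qed (use j(2) \<phi>(2) S_carrier \<sigma>(3) in \<open>simp add: \<tau>_def\<close>)
  have \<phi>_\<theta>: "(\<phi> \<circ> \<theta>) c = (\<one>\<^bsub>D\<^esub>, c)" if "c \<in> carrier ?F" for c
  proof (rule hom_free_Abelian_group_eqI[OF DF.is_group Group.hom_compose[OF \<theta>(1) \<phi>(1)] _ _ that])
    show "(\<lambda>c. (\<one>\<^bsub>D\<^esub>, c)) \<in> hom ?F (D \<times>\<times> ?F)" by (rule homI) simp_all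
    fix C assume C: "C \<in> ?N"
    have s: "\<sigma> (r C) \<in> carrier D" using \<sigma>(1) r(1)[OF C] .
    have "(\<phi> \<circ> \<theta>) (frag_of C) = \<phi> (A.d (r C)) \<otimes>\<^bsub>D \<times>\<times> ?F\<^esub> inv\<^bsub>D \<times>\<times> ?F\<^esub> \<phi> (j (\<sigma> (r C)))"
      using r(1)[OF C] s by (simp add: \<theta>(2)[OF C] z_def A_S)
    also have "\<phi> (j (\<sigma> (r C))) = (\<sigma> (r C), 0)" using \<phi>_j[OF s] by simp
    also have "\<phi> (A.d (r C)) = (\<sigma> (r C), frag_of C)" using r[OF C] by (simp add: \<phi>(2) \<tau>_def)
    also have "(\<sigma> (r C), frag_of C) \<otimes>\<^bsub>D \<times>\<times> ?F\<^esub> inv\<^bsub>D \<times>\<times> ?F\<^esub> (\<sigma> (r C), 0) = (\<one>\<^bsub>D\<^esub>, frag_of C)"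
      using s by (simp add: inv_DirProd[OF D.is_group F.is_group])
    finally show "(\<phi> \<circ> \<theta>) (frag_of C) = (\<one>\<^bsub>D\<^esub>, frag_of C)" .
  qed
  have \<phi>_\<psi>: "\<phi> (\<psi> p) = p" if p_in: "p \<in> carrier (D \<times>\<times> ?F)" for p
  proof -
    obtain x c where p: "p = (x, c)" "x \<in> carrier D" "c \<in> carrier ?F" using p_in by (cases p) auto
    have "\<phi> (\<psi> p) = \<phi> (j x) \<otimes>\<^bsub>D \<times>\<times> ?F\<^esub> \<phi> (\<theta> c)"
      unfolding p(1) \<psi>_def prod.case by (rule \<phi>.hom_mult) (use p(2) \<theta>.hom_closed[OF p(3)] in simp_all)
    also have "\<dots> = p" using \<phi>_j[OF p(2)] \<phi>_\<theta>[OF p(3)] p(2) by (simp add: p(1))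
    finally show ?thesis .
  qed

  have "y \<in> \<psi> ` carrier (D \<times>\<times> ?F)" if "y \<in> carrier ?A" for y
    using that
  proof (induction rule: A.Dehn_group_induct)
    case one
    show ?case using \<psi>.hom_one DF.one_closed by (metis imageI)
  next
    case (gen a)
    then have a: "a \<in> carrier G" by (simp add: A_S)
    show ?case
    proof (cases "a \<in> S")
      case True
      then have "A.d a = \<psi> (d a, 0)" using j(2) \<theta>.hom_one gen by (simp add: \<psi>_def)
      with True show ?thesis by (intro image_eqI[of _ \<psi> "(d a, 0)"]) simp_all
    next
      case False
      define C where "C = conj_class G a"
      have C: "C \<in> ?N" using False a conj_class_nongen_iff by (simp add: C_def)
      have "a \<in> conj_class G (r C)" using r(3)[OF C] conj_class_self[OF a] by (simp add: C_def)
      \<comment> \<open>\<open>a\<close> is the conjugate of the representative by \<open>g\<close>.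
        A lift \<open>w\<close> of \<open>g\<close> to \<open>D\<close> maps to an element of
        \<open>A(G)\<close> over \<open>g\<close>, which conjugates the generator of
        \<open>r C\<close> to that of \<open>a\<close>.\<close>
      then obtain g where g: "g \<in> carrier G" "a = inv g \<otimes> r C \<otimes> g" by (auto simp: conj_class_def)
      obtain w where w: "w \<in> carrier D" "proj w = g" using proj_surj[OF g(1)] .
      have s: "\<sigma> (r C) \<in> carrier D" using \<sigma>(1) r(1)[OF C] .
      have zc: "z C \<in> center ?A" using \<theta>(2)[OF C] \<theta>(3)[of "frag_of C"] C by simp
      have dr: "A.d (r C) = z C \<otimes>\<^bsub>?A\<^esub> j (\<sigma> (r C))"
        using r(1)[OF C] s by (simp add: z_def A_S A.D.m_assoc)
      have "A.d a = inv\<^bsub>?A\<^esub> j w \<otimes>\<^bsub>?A\<^esub> A.d (r C) \<otimes>\<^bsub>?A\<^esub> j w"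
        using A.conj_d[of "j w" "r C"] w r(1)[OF C] g(2) by (simp add: A_S proj_j)
      \<comment> \<open>Conjugation leaves the central factor \<open>z C\<close> alone; what remains
        lies in the image of \<open>j\<close>.\<close>
      also have "\<dots> = inv\<^bsub>?A\<^esub> j w \<otimes>\<^bsub>?A\<^esub> j (\<sigma> (r C)) \<otimes>\<^bsub>?A\<^esub> (z C \<otimes>\<^bsub>?A\<^esub> j w)"
        unfolding dr center_commute[OF zc j.hom_closed[OF s]]
        using w s center_carrier[OF zc] by (simp add: A.D.m_assoc)
      also have "z C \<otimes>\<^bsub>?A\<^esub> j w = j w \<otimes>\<^bsub>?A\<^esub> z C" by (rule center_commute[OF zc j.hom_closed[OF w(1)]])
      also have "inv\<^bsub>?A\<^esub> j w \<otimes>\<^bsub>?A\<^esub> j (\<sigma> (r C)) \<otimes>\<^bsub>?A\<^esub> (j w \<otimes>\<^bsub>?A\<^esub> z C)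
          = \<psi> (inv\<^bsub>D\<^esub> w \<otimes>\<^bsub>D\<^esub> \<sigma> (r C) \<otimes>\<^bsub>D\<^esub> w, frag_of C)"
        using w s center_carrier[OF zc] by (simp add: \<psi>_def \<theta>(2)[OF C] A.D.m_assoc)
      finally show ?thesis by (rule image_eqI) (use w s C in simp)
    qed
  next
    case (inv x)
    then obtain p where p: "p \<in> carrier (D \<times>\<times> ?F)" "x = \<psi> p" by blast
    show ?case by (rule image_eqI[OF _ DF.inv_closed[OF p(1)]]) (simp only: p(2) \<psi>.hom_inv[OF p(1)])
  next
    case (mult x y)
    then obtain p q where p: "p \<in> carrier (D \<times>\<times> ?F)" "x = \<psi> p"
      and q: "q \<in> carrier (D \<times>\<times> ?F)" "y = \<psi> q" by blast
    show ?case
      by (rule image_eqI[OF _ DF.m_closed[OF p(1) q(1)]]) (simp only: p(2) q(2) \<psi>.hom_mult[OF p(1) q(1)])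
  qed
  then have "\<psi> ` carrier (D \<times>\<times> ?F) = carrier ?A" using \<psi>.hom_closed by blast
  moreover have "inj_on \<psi> (carrier (D \<times>\<times> ?F))" by (rule inj_on_inverseI[of _ \<phi>]) (rule \<phi>_\<psi>)
  ultimately have "D \<times>\<times> ?F \<cong> ?A"
    using \<psi>_hom unfolding is_iso_def by (blast intro: iso_iff[THEN iffD2])
  then show ?thesis unfolding A_eq by (rule DF.iso_sym)
qed

end

theorem theorem3:
  fixes G :: "('a, 'm) monoid_scheme"
    and X :: "'x set" and R :: "('x word \<times> 'x word) set" and \<iota> :: "'x \<Rightarrow> 'a"
  assumes "group G"
    and "Cbar_presentation G X R \<iota>"
  shows "A_group G \<cong> Dehn_group G (\<iota> ` X) \<times>\<times> free_Abelian_group (nongen_classes G (\<iota> ` X))"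
proof -
  interpret cbar G X R \<iota>
    using assms by (simp add: cbar_def cbar_axioms_def)
  show ?thesis by (rule A_group_iso)
qed

end
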